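(* Let $1<q_1<q_2<\dots<q_N$, $\bm y=(y_1>\dots>y_N)\in\mathbb{Z}^N$ and $1\le n\le N$. Let $$G(z_1,z_2):=\sum_{i=1}^nQ_{[1,i]}(z_1,y_i)\cdot h_{n-i}^n(0,z_2),$$ where the functions $h_k^n$, $0\le k\le n-1$, are the solutions of the terminal-boundary value problem in the context. Then, for any $z_1,z_2\in\mathbb{Z}$, $$G(z_1,z_2)=\frac{\mathbb{E}_{S_0=z_1}\big[\hat Q_{[\tau+1,n]}(S_\tau,z_2)\,\mathbf{1}_{\tau<n}\big]}{\prod_{\ell=1}^n(q_\ell-1)}.$$
   Context: Kernels on $\mathbb{Z}\times\mathbb{Z}$ are composed by $(A\circ B)(x,z)=\sum_yA(x,y)B(y,z)$. $Q_i(x,y)=q_i^{y-x}\mathbf{1}_{\{y<x\}}$, $Q_i^\dagger(x,y)=q_i^{y-x}\mathbf{1}_{\{y\ge x\}}$, $Q_{[j,k]}=Q_j\circ\cdots\circ Q_k$, $Q^\dagger_{[j,k]}=Q_j^\dagger\circ\cdots\circ Q_k^\dagger$, $\bar Q_{[j,k]}:=Q_{[j,k]}+(-1)^{k-j}Q^\dagger_{[j,k]}$ and $\hat Q_{[j,k]}:=\big(\prod_{\ell=j}^k(q_\ell-1)\big)\bar Q_{[j,k]}$ for $1\le j\le k\le n$. For $0\le k\le n-1$, $h_k^n(\ell,x)$ ($0\le\ell\le k$, $x\in\mathbb{Z}$) solves: $h_k^n(\ell+1,x)=-h_k^n(\ell,x)+q_{n-\ell}h_k^n(\ell,x-1)$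 for $x\in\mathbb{Z}$, $\ell<k$; $h_k^n(\ell,y_{n-\ell})=0$ for $\ell<k$; $h_k^n(k,x)=q_{n-k}^{x-y_{n-k}}$ for $x\in\mathbb{Z}$. (These conditions determine $h_k^n$ uniquely.) $S=(S_0,\dots,S_n)$ is the geometric random walk moving strictly to the left with $\mathbb{P}(S_\ell=y\mid S_{\ell-1}=x)=(q_\ell-1)q_\ell^{y-x}\mathbf{1}_{y<x}$ for $1\le\ell\le n$, and $\tau:=\min\{m\in\{0,\dots,n\}:S_m>y_{m+1}\}$, where here $y_{n+1}:=-\infty$. *)

theory Defs
  imports "HOL-Probability.Probability"
begin

type_synonym kernel = "int \<Rightarrow> int \<Rightarrow> real"

(* In every composition used here the summand has finite support in y,
   so the infinite sum is an ordinary finite one. *)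
definition kernel_comp :: "kernel \<Rightarrow> kernel \<Rightarrow> kernel" where
  "kernel_comp A B = (\<lambda>x z. \<Sum>\<^sub>\<infinity>y\<in>UNIV. A x y * B y z)"

(* kernel_chain K j k is K j o K (j+1) o ... o K k for j <= k; the value for j > k is junk. *)
function kernel_chain :: "(nat \<Rightarrow> kernel) \<Rightarrow> nat \<Rightarrow> nat \<Rightarrow> kernel" where
  "kernel_chain K j k =
     (if j < k then kernel_comp (K j) (kernel_chain K (Suc j) k) else K j)"
  by auto
termination by (relation "Wellfounded.measure (\<lambda>(K, j, k). k - j)") auto

declare kernel_chain.simps [simp del]

definition Q_kernel :: "(nat \<Rightarrow> real) \<Rightarrow> nat \<Rightarrow> kernel" where
  "Q_kernel q i = (\<lambda>x y. q i powi (y - x) * of_bool (y < x))"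

definition Q_dag :: "(nat \<Rightarrow> real) \<Rightarrow> nat \<Rightarrow> kernel" where
  "Q_dag q i = (\<lambda>x y. q i powi (y - x) * of_bool (y \<ge> x))"

definition Q_range :: "(nat \<Rightarrow> real) \<Rightarrow> nat \<Rightarrow> nat \<Rightarrow> kernel" where
  "Q_range q j k = kernel_chain (Q_kernel q) j k"

definition Q_dag_range :: "(nat \<Rightarrow> real) \<Rightarrow> nat \<Rightarrow> nat \<Rightarrow> kernel" where
  "Q_dag_range q j k = kernel_chain (Q_dag q) j k"

definition Q_bar :: "(nat \<Rightarrow> real) \<Rightarrow> nat \<Rightarrow> nat \<Rightarrow> kernel" where
  "Q_bar q j k = (\<lambda>x y. Q_range q j k x y + (-1) ^ (k - j) * Q_dag_range q j k x y)"

definition Q_hat :: "(nat \<Rightarrow> real) \<Rightarrow> nat \<Rightarrow> nat \<Rightarrow> kernel" where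
  "Q_hat q j k = (\<lambda>x y. (\<Prod>l=j..k. (q l - 1)) * Q_bar q j k x y)"

(* g l x stands for h_k^n(l, x); only the values at l <= k are constrained. *)
definition terminal_boundary_solution ::
    "(nat \<Rightarrow> real) \<Rightarrow> (nat \<Rightarrow> int) \<Rightarrow> nat \<Rightarrow> nat \<Rightarrow> (nat \<Rightarrow> int \<Rightarrow> real) \<Rightarrow> bool" where
  "terminal_boundary_solution q y n k g \<longleftrightarrow>
     (\<forall>l<k. \<forall>x. g (l + 1) x = - g l x + q (n - l) * g l (x - 1)) \<and>
     (\<forall>l<k. g l (y (n - l)) = 0) \<and>
     (\<forall>x. g k x = q (n - k) powi (x - y (n - k)))"

(* S_0, ..., S_n is a Markov chain with S_0 = z almost surely: the transition probabilities
   are prescribed conditionally on every history x_0, ..., x_{l-1} of positive probability. *)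
definition geometric_walk ::
    "'a measure \<Rightarrow> (nat \<Rightarrow> real) \<Rightarrow> nat \<Rightarrow> int \<Rightarrow> (nat \<Rightarrow> 'a \<Rightarrow> int) \<Rightarrow> bool" where
  "geometric_walk M q n z S \<longleftrightarrow>
     prob_space M \<and>
     (\<forall>l\<le>n. S l \<in> M \<rightarrow>\<^sub>M count_space UNIV) \<and>
     (AE \<omega> in M. S 0 \<omega> = z) \<and>
     (\<forall>l\<in>{1..n}. \<forall>(x :: nat \<Rightarrow> int) b.
        \<P>(\<omega> in M. \<forall>i<l. S i \<omega> = x i) > 0 \<longrightarrow>
        \<P>(\<omega> in M. S l \<omega> = b \<bar> \<forall>i<l. S i \<omega> = x i) =
          (q l - 1) * q l powi (b - x (l - 1)) * of_bool (b < x (l - 1)))"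

definition barrier :: "(nat \<Rightarrow> int) \<Rightarrow> nat \<Rightarrow> nat \<Rightarrow> ereal" where
  "barrier y n m = (if m \<le> n then ereal (of_int (y m)) else - \<infinity>)"

(* The set contains n because barrier y n (n + 1) = -\<infinity>. *)
definition hitting_time ::
    "(nat \<Rightarrow> int) \<Rightarrow> nat \<Rightarrow> (nat \<Rightarrow> 'a \<Rightarrow> int) \<Rightarrow> 'a \<Rightarrow> nat" where
  "hitting_time y n S \<omega> =
     Min {m \<in> {0..n}. ereal (of_int (S m \<omega>)) > barrier y n (m + 1)}"

definition G_kernel ::
    "(nat \<Rightarrow> real) \<Rightarrow> (nat \<Rightarrow> int) \<Rightarrow> nat \<Rightarrow> (nat \<Rightarrow> nat \<Rightarrow> int \<Rightarrow> real) \<Rightarrow> kernel" where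
  "G_kernel q y n h = (\<lambda>z1 z2. \<Sum>i=1..n. Q_range q 1 i z1 (y i) * h (n - i) 0 z2)"

end

theory Submission
  imports Defs
begin

text \<open>
  Fix \<open>z\<^sub>1\<close>. Both sides are the case \<open>m = n\<close> of a family of functions \<open>F\<^sub>m(x)\<close>, \<open>0 \<le> m \<le> n\<close>, of
  the second variable \<open>x\<close>, and both families solve the same triangular system
  \<open>F\<^sub>0 = 0\<close>,  \<open>- F\<^sub>m(x) + q\<^sub>m F\<^sub>m(x - 1) = F\<^sub>m\<^sub>-\<^sub>1(x)\<close>,  \<open>F\<^sub>m(y\<^sub>m) = Q\<^bsub>[1,m]\<^esub>(z\<^sub>1, y\<^sub>m)\<close>,
  which has at most one solution: a difference of two solutions is multiplied by \<open>q\<^sub>m\<close> in each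
  step of \<open>x\<close> and vanishes at \<open>y\<^sub>m\<close> (\<open>twisted_diff_unique\<close>).

  On the left, \<open>F\<^sub>m(x) = (\<Sum>i\<le>m. Q\<^bsub>[1,i]\<^esub>(z\<^sub>1, y\<^sub>i) h\<^bsub>n-i\<^esub>(n - m, x))\<close>. The recursion for \<open>h\<close> lowers \<open>m\<close> in the
  terms \<open>i < m\<close> and the terminal function, a power of \<open>q\<^sub>m\<close>, is annihilated; at \<open>x = y\<^sub>m\<close> only the
  term \<open>i = m\<close> is left (\<open>boundary_value_sum_eq_passage_kernel\<close>).

  On the right, let \<open>\<tau>\<close> be the first time the walk is above the barrier. Splitting according to
  \<open>\<tau> = k < m\<close> and \<open>S\<^sub>k = w\<close> gives, after division by the factors \<open>q\<^sub>l - 1\<close>, the finite sum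
  \<open>F\<^sub>m(x) = (\<Sum>k<m. \<Sum>w>y\<^sub>k\<^sub>+\<^sub>1. a\<^sub>k(w) Qbar\<^bsub>[k+1,m]\<^esub>(w, x))\<close>,
  where \<open>a\<^sub>k(w)\<close> is the rescaled probability that \<open>S\<^sub>k = w\<close> and \<open>\<tau> \<ge> k\<close>. The difference operator
  removes the last factor of \<open>Q\<close>, and of \<open>Q\<^sup>\<dagger>\<close> with the opposite sign; the sign in \<open>Qbar\<close>
  absorbs this, and \<open>Qbar\<^bsub>[m,m]\<^esub>\<close> is a pure power, which is annihilated
  (\<open>twisted_diff_Q_bar\<close>, \<open>twisted_diff_Q_bar_refl\<close>). For the value at \<open>x = y\<^sub>m\<close>, every \<open>w\<close> in the sum lies
  strictly above \<open>y\<^sub>m\<close>, so \<open>Q\<^sup>\<dagger>\<close> does not contribute. What remains says that a path reaching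
  \<open>y\<^sub>m\<close> at time \<open>m\<close> must have passed the barrier before, because it was strictly above \<open>y\<^sub>m\<close> at
  time \<open>m - 1\<close>; so all paths from \<open>z\<^sub>1\<close> to \<open>y\<^sub>m\<close> are counted, which is \<open>Q\<^bsub>[1,m]\<^esub>(z\<^sub>1, y\<^sub>m)\<close>
  (\<open>passage_kernel_boundary\<close>).

  The probabilistic part (\<open>expectation_at_hitting_time\<close>) only identifies \<open>a\<^sub>k(w)\<close>. The transition
  probabilities are prescribed conditionally on complete histories; as there are countably many
  histories, they can be summed to transition probabilities conditional on any event
  of the past (\<open>geometric_walk_markov\<close>).
\<close>

section \<open>Composition of triangular kernels\<close>

lemma kernel_comp_eq_sum:
  assumes "finite F" and "\<And>v. v \<notin> F \<Longrightarrow> A x v * B v z = 0"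
  shows "kernel_comp A B x z = (\<Sum>v\<in>F. A x v * B v z)"
proof -
  have "(\<Sum>\<^sub>\<infinity>v\<in>UNIV. A x v * B v z) = (\<Sum>\<^sub>\<infinity>v\<in>F. A x v * B v z)"
    using assms(2) by (intro infsum_cong_neutral) auto
  then show ?thesis
    using assms(1) by (simp add: kernel_comp_def)
qed

lemma Q_range_refl: "Q_range q k k = Q_kernel q k"
  by (simp add: Q_range_def kernel_chain.simps)

lemma Q_range_step: "j < k \<Longrightarrow> Q_range q j k = kernel_comp (Q_kernel q j) (Q_range q (Suc j) k)"
  by (simp add: Q_range_def kernel_chain.simps[of _ j k])

lemma Q_dag_range_refl: "Q_dag_range q k k = Q_dag q k"
  by (simp add: Q_dag_range_def kernel_chain.simps)

lemma Q_dag_range_step: "j < k \<Longrightarrow> Q_dag_range q j k = kernel_comp (Q_dag q j) (Q_dag_range q (Suc j) k)"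
  by (simp add: Q_dag_range_def kernel_chain.simps[of _ j k])

lemma Q_range_eq_0:
  assumes "j \<le> k" and "w \<le> x"
  shows "Q_range q j k w x = 0"
  using assms
proof (induction j arbitrary: w rule: inc_induct)
  case base
  then show ?case by (simp add: Q_range_refl Q_kernel_def)
next
  case (step j)
  have "kernel_comp (Q_kernel q j) (Q_range q (Suc j) k) w x
      = (\<Sum>v\<in>{}. Q_kernel q j w v * Q_range q (Suc j) k v x)"
    using step by (intro kernel_comp_eq_sum) (auto simp: Q_kernel_def)
  then show ?case
    using step by (simp add: Q_range_step)
qed

lemma Q_dag_range_eq_0:
  assumes "j \<le> k" and "x < w"
  shows "Q_dag_range q j k w x = 0"
  using assms
proof (induction j arbitrary: w rule: inc_induct)
  case base
  then show ?case by (simp add: Q_dag_range_refl Q_dag_def)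
next
  case (step j)
  have "kernel_comp (Q_dag q j) (Q_dag_range q (Suc j) k) w x
      = (\<Sum>v\<in>{}. Q_dag q j w v * Q_dag_range q (Suc j) k v x)"
    using step by (intro kernel_comp_eq_sum) (auto simp: Q_dag_def)
  then show ?case
    using step by (simp add: Q_dag_range_step)
qed

text \<open>
  The freedom in the index set \<open>F\<close> allows the same finite sum to be used at neighbouring
  arguments \<open>x\<close> and \<open>x - 1\<close>, where the exact supports differ.
\<close>
lemma Q_range_step_sum:
  assumes "j < k" and "finite F" and "{x..<w} \<subseteq> F"
  shows "Q_range q j k w x = (\<Sum>v\<in>F. Q_kernel q j w v * Q_range q (Suc j) k v x)"
  unfolding Q_range_step[OF assms(1)]
proof (rule kernel_comp_eq_sum[OF assms(2)])
  fix v assume "v \<notin> F"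
  then have "v \<notin> {x..<w}" using assms(3) by blast
  then have "v < x \<or> w \<le> v" by auto
  then show "Q_kernel q j w v * Q_range q (Suc j) k v x = 0"
    using assms(1) by (auto simp: Q_kernel_def Q_range_eq_0)
qed

lemma Q_dag_range_step_sum:
  assumes "j < k" and "finite F" and "{w..x} \<subseteq> F"
  shows "Q_dag_range q j k w x = (\<Sum>v\<in>F. Q_dag q j w v * Q_dag_range q (Suc j) k v x)"
  unfolding Q_dag_range_step[OF assms(1)]
proof (rule kernel_comp_eq_sum[OF assms(2)])
  fix v assume "v \<notin> F"
  then have "v \<notin> {w..x}" using assms(3) by blast
  then have "v < w \<or> x < v" by auto
  then show "Q_dag q j w v * Q_dag_range q (Suc j) k v x = 0"
    using assms(1) by (auto simp: Q_dag_def Q_dag_range_eq_0)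
qed

section \<open>A difference operator inverting one step\<close>

definition twisted_diff :: "real \<Rightarrow> (int \<Rightarrow> real) \<Rightarrow> int \<Rightarrow> real" where
  "twisted_diff c f x = - f x + c * f (x - 1)"

lemma twisted_diff_sum:
  "twisted_diff c (\<lambda>x. \<Sum>i\<in>I. f i x) x = (\<Sum>i\<in>I. twisted_diff c (f i) x)"
  by (simp add: twisted_diff_def sum_subtractf sum_distrib_left)

lemma twisted_diff_cmult: "twisted_diff c (\<lambda>x. a * f x) x = a * twisted_diff c f x"
  by (simp add: twisted_diff_def algebra_simps)

lemma twisted_diff_add:
  "twisted_diff c (\<lambda>x. f x + g x) x = twisted_diff c f x + twisted_diff c g x"
  by (simp add: twisted_diff_def algebra_simps)

lemma twisted_diff_power_int:
  assumes "c \<noteq> 0"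
  shows "twisted_diff c (\<lambda>x. c powi (x - a)) x = 0"
proof -
  have "c * c powi (x - 1 - a) = c powi (x - a)"
    using power_int_add_1[of c "x - 1 - a"] assms by (simp add: algebra_simps)
  then show ?thesis by (simp add: twisted_diff_def)
qed

text \<open>
  \<open>Q\<close> and \<open>Q\<^sup>\<dagger>\<close> are the two truncations of the same power function, which the operator
  annihilates; a jump is left at the cut, with opposite signs for the two. So \<open>Q\<close> and \<open>-Q\<^sup>\<dagger>\<close> are
  both right inverses of the operator.
\<close>
lemma twisted_diff_Q_kernel:
  assumes "q k \<noteq> 0"
  shows "twisted_diff (q k) (Q_kernel q k w) x = of_bool (w = x)"
  using twisted_diff_power_int[OF assms, of w x] assms
  by (auto simp: twisted_diff_def Q_kernel_def)

lemma twisted_diff_Q_dag: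
  assumes "q k \<noteq> 0"
  shows "twisted_diff (q k) (Q_dag q k w) x = - of_bool (w = x)"
  using twisted_diff_power_int[OF assms, of w x] assms
  by (auto simp: twisted_diff_def Q_dag_def)

text \<open>
  The operator acts on the second variable and therefore only meets the last factor
  of the composition.
\<close>
lemma twisted_diff_Q_range:
  assumes "j \<le> k" and "q (Suc k) \<noteq> 0"
  shows "twisted_diff (q (Suc k)) (Q_range q j (Suc k) w) x = Q_range q j k w x"
  using assms(1)
proof (induction j arbitrary: w rule: inc_induct)
  case base
  let ?F = "{x - 1..max w x}"
  have expand: "Q_range q k (Suc k) w u = (\<Sum>v\<in>?F. Q_kernel q k w v * Q_range q (Suc k) (Suc k) v u)"
    if "u = x \<or> u = x - 1" for u
    using that by (intro Q_range_step_sum) auto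
  have "twisted_diff (q (Suc k)) (Q_range q k (Suc k) w) x =
    twisted_diff (q (Suc k)) (\<lambda>x. \<Sum>v\<in>?F. Q_kernel q k w v * Q_range q (Suc k) (Suc k) v x) x"
    unfolding twisted_diff_def by (simp add: expand)
  also have "\<dots> = (\<Sum>v\<in>?F. Q_kernel q k w v * of_bool (v = x))"
    by (simp add: twisted_diff_sum twisted_diff_cmult Q_range_refl twisted_diff_Q_kernel assms)
  also have "\<dots> = Q_kernel q k w x"
    by (simp add: of_bool_def sum.delta if_distrib cong: if_cong)
  finally show ?case by (simp add: Q_range_refl)
next
  case (step j)
  let ?F = "{x - 1..max w x}"
  have expand: "Q_range q j (Suc k) w u = (\<Sum>v\<in>?F. Q_kernel q j w v * Q_range q (Suc j) (Suc k) v u)"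
    if "u = x \<or> u = x - 1" for u
    using that step.hyps by (intro Q_range_step_sum) auto
  have "twisted_diff (q (Suc k)) (Q_range q j (Suc k) w) x =
    twisted_diff (q (Suc k)) (\<lambda>x. \<Sum>v\<in>?F. Q_kernel q j w v * Q_range q (Suc j) (Suc k) v x) x"
    unfolding twisted_diff_def by (simp add: expand)
  also have "\<dots> = (\<Sum>v\<in>?F. Q_kernel q j w v * Q_range q (Suc j) k v x)"
    by (simp add: twisted_diff_sum twisted_diff_cmult step.IH)
  also have "\<dots> = Q_range q j k w x"
    using step by (subst Q_range_step_sum[where F = ?F]) auto
  finally show ?case .
qed

lemma twisted_diff_Q_dag_range:
  assumes "j \<le> k" and "q (Suc k) \<noteq> 0"
  shows "twisted_diff (q (Suc k)) (Q_dag_range q j (Suc k) w) x = - Q_dag_range q j k w x"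
  using assms(1)
proof (induction j arbitrary: w rule: inc_induct)
  case base
  let ?F = "{min w x..x}"
  have expand: "Q_dag_range q k (Suc k) w u = (\<Sum>v\<in>?F. Q_dag q k w v * Q_dag_range q (Suc k) (Suc k) v u)"
    if "u = x \<or> u = x - 1" for u
    using that by (intro Q_dag_range_step_sum) auto
  have "twisted_diff (q (Suc k)) (Q_dag_range q k (Suc k) w) x =
    twisted_diff (q (Suc k)) (\<lambda>x. \<Sum>v\<in>?F. Q_dag q k w v * Q_dag_range q (Suc k) (Suc k) v x) x"
    unfolding twisted_diff_def by (simp add: expand)
  also have "\<dots> = (\<Sum>v\<in>?F. Q_dag q k w v * - of_bool (v = x))"
    unfolding twisted_diff_sum twisted_diff_cmult Q_dag_range_refl
    by (simp only: twisted_diff_Q_dag[of q "Suc k", OF assms(2)])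
  also have "\<dots> = - Q_dag q k w x"
    by (simp add: of_bool_def sum.delta if_distrib sum_negf cong: if_cong)
  finally show ?case by (simp add: Q_dag_range_refl)
next
  case (step j)
  let ?F = "{min w x..x}"
  have expand: "Q_dag_range q j (Suc k) w u = (\<Sum>v\<in>?F. Q_dag q j w v * Q_dag_range q (Suc j) (Suc k) v u)"
    if "u = x \<or> u = x - 1" for u
    using that step.hyps by (intro Q_dag_range_step_sum) auto
  have "twisted_diff (q (Suc k)) (Q_dag_range q j (Suc k) w) x =
    twisted_diff (q (Suc k)) (\<lambda>x. \<Sum>v\<in>?F. Q_dag q j w v * Q_dag_range q (Suc j) (Suc k) v x) x"
    unfolding twisted_diff_def by (simp add: expand)
  also have "\<dots> = - (\<Sum>v\<in>?F. Q_dag q j w v * Q_dag_range q (Suc j) k v x)"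
    by (simp add: twisted_diff_sum twisted_diff_cmult step.IH sum_negf)
  also have "\<dots> = - Q_dag_range q j k w x"
    using step by (subst (2) Q_dag_range_step_sum[where F = ?F]) auto
  finally show ?case .
qed

text \<open>
  The minus sign that the operator produces on the dagger part is the change
  of \<open>(-1)\<^bsup>k-j\<^esup>\<close> when \<open>k\<close> drops by one.
\<close>
lemma twisted_diff_Q_bar:
  assumes "j \<le> k" and "q (Suc k) \<noteq> 0"
  shows "twisted_diff (q (Suc k)) (Q_bar q j (Suc k) w) x = Q_bar q j k w x"
  using assms unfolding Q_bar_def twisted_diff_add twisted_diff_cmult
  by (simp add: twisted_diff_Q_range twisted_diff_Q_dag_range Suc_diff_le)

text \<open>
  For a single factor the two truncations add up to the full power function.
\<close>
lemma twisted_diff_Q_bar_refl: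
  assumes "q k \<noteq> 0"
  shows "twisted_diff (q k) (Q_bar q k k w) x = 0"
  using assms unfolding Q_bar_def twisted_diff_add twisted_diff_cmult
  by (simp add: Q_range_refl Q_dag_range_refl twisted_diff_Q_kernel twisted_diff_Q_dag)

lemma twisted_diff_unique:
  assumes "c \<noteq> 0" and diff: "\<And>x. twisted_diff c f x = twisted_diff c g x" and eq: "f a = g a"
  shows "f x = g x"
proof (induction x rule: int_induct[where k = a])
  case base
  show ?case by (rule eq)
next
  case (step1 i)
  then show ?case using diff[of "i + 1"] by (simp add: twisted_diff_def)
next
  case (step2 i)
  then show ?case using diff[of i] assms(1) by (simp add: twisted_diff_def)
qed

section \<open>The walk before it passes the barrier\<close>

text \<open>
  Up to the factor \<open>(\<Prod>l\<le>k. q l - 1)\<close>, this is the probability that the walk started at \<open>z\<close> is at \<open>w\<close> at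
  time \<open>k\<close> and has stayed below or on the barrier at all times \<open>j < k\<close>, see \<open>prob_taboo\<close>. The
  walk never exceeds \<open>z\<close> and moves strictly to the left, so the previous position lies
  between \<open>w\<close> and \<open>z\<close>, and all sums are finite.
\<close>
fun taboo :: "(nat \<Rightarrow> real) \<Rightarrow> (nat \<Rightarrow> int) \<Rightarrow> int \<Rightarrow> nat \<Rightarrow> int \<Rightarrow> real" where
  "taboo q y z 0 w = of_bool (w = z)"
| "taboo q y z (Suc k) w =
     (\<Sum>v\<in>{w<..min z (y (Suc k))}. taboo q y z k v * Q_kernel q (Suc k) v w)"

text \<open>
  The right-hand side of the main identity with \<open>m\<close> for \<open>n\<close>: \<open>k\<close> is the time and \<open>w\<close>
  the position at which the walk passes the barrier.
\<close>
definition passage_kernel :: "(nat \<Rightarrow> real) \<Rightarrow> (nat \<Rightarrow> int) \<Rightarrow> nat \<Rightarrow> kernel" where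
  "passage_kernel q y m z x =
     (\<Sum>k<m. \<Sum>w\<in>{y (Suc k)<..z}. taboo q y z k w * Q_bar q (Suc k) m w x)"

lemma twisted_diff_passage_kernel:
  assumes "q (Suc m) \<noteq> 0"
  shows "twisted_diff (q (Suc m)) (passage_kernel q y (Suc m) z) x = passage_kernel q y m z x"
  using assms unfolding passage_kernel_def twisted_diff_sum twisted_diff_cmult
  by (simp add: twisted_diff_Q_bar twisted_diff_Q_bar_refl)

text \<open>
  \<open>T k\<close> is the weight of the paths that reach \<open>x\<close> at time \<open>m\<close> and have not passed the barrier before time \<open>k\<close>. They
  either pass it at time \<open>k\<close>, or are still unpassed at time \<open>k + 1\<close> and so
  contribute to \<open>T (k + 1)\<close>.
\<close>
lemma taboo_renewal:
  fixes q :: "nat \<Rightarrow> real" and z :: int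
  assumes "k < m" and "x \<le> y (Suc k)"
  defines "T \<equiv> \<lambda>k. \<Sum>w\<in>{x..z}. taboo q y z k w * Q_range q (Suc k) m w x"
  shows "T k = (\<Sum>w\<in>{y (Suc k)<..z}. taboo q y z k w * Q_range q (Suc k) m w x)
    + (\<Sum>w\<in>{x..min z (y (Suc k))}. taboo q y z k w * Q_range q (Suc k) m w x)"
    and "Suc k < m \<Longrightarrow>
      (\<Sum>w\<in>{x..min z (y (Suc k))}. taboo q y z k w * Q_range q (Suc k) m w x) = T (Suc k)"
proof -
  have "{x..z} = {y (Suc k)<..z} \<union> {x..min z (y (Suc k))}"
    using assms(2) by auto
  then show "T k = (\<Sum>w\<in>{y (Suc k)<..z}. taboo q y z k w * Q_range q (Suc k) m w x)
    + (\<Sum>w\<in>{x..min z (y (Suc k))}. taboo q y z k w * Q_range q (Suc k) m w x)"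
    unfolding T_def by (simp only:) (rule sum.union_disjoint, auto)
next
  assume "Suc k < m"
  let ?Y = "{x..min z (y (Suc k))}"
  have "(\<Sum>w\<in>?Y. taboo q y z k w * Q_range q (Suc k) m w x) =
    (\<Sum>w\<in>?Y. \<Sum>v\<in>{x..z}. taboo q y z k w * Q_kernel q (Suc k) w v * Q_range q (Suc (Suc k)) m v x)"
    using \<open>Suc k < m\<close>
    by (intro sum.cong refl, subst Q_range_step_sum[where F = "{x..z}"])
       (auto simp: sum_distrib_left mult.assoc)
  also have "\<dots> = (\<Sum>v\<in>{x..z}.
      (\<Sum>w\<in>?Y. taboo q y z k w * Q_kernel q (Suc k) w v) * Q_range q (Suc (Suc k)) m v x)"
    by (subst sum.swap) (simp add: sum_distrib_right)
  also have "\<dots> = T (Suc k)"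
    unfolding T_def
  proof (intro sum.cong refl arg_cong2[where f = "(*)"])
    fix v assume "v \<in> {x..z}"
    then show "(\<Sum>w\<in>?Y. taboo q y z k w * Q_kernel q (Suc k) w v) = taboo q y z (Suc k) v"
      unfolding taboo.simps by (intro sum.mono_neutral_right) (auto simp: Q_kernel_def)
  qed
  finally show "(\<Sum>w\<in>?Y. taboo q y z k w * Q_range q (Suc k) m w x) = T (Suc k)" .
qed

text \<open>
  Telescoping the renewal relation. It stops at \<open>k = m - 1\<close>: from a position on or below \<open>y m\<close>
  a strictly decreasing path cannot reach \<open>y m\<close> in the last step.
\<close>
lemma passage_kernel_boundary:
  assumes "1 \<le> m" and "\<And>k. k < m \<Longrightarrow> y m \<le> y (Suc k)"
  shows "passage_kernel q y m z (y m) = Q_range q 1 m z (y m)"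
proof -
  define T where "T = (\<lambda>k. \<Sum>w\<in>{y m..z}. taboo q y z k w * Q_range q (Suc k) m w (y m))"
  define P where "P = (\<lambda>k. \<Sum>w\<in>{y (Suc k)<..z}. taboo q y z k w * Q_range q (Suc k) m w (y m))"
  have telescope: "T 0 = (\<Sum>i<k. P i) + T k" if "k < m" for k
    using that
  proof (induction k)
    case (Suc k)
    then show ?case
      using taboo_renewal[of k m "y m" y q z] assms(2)[of k] by (simp add: T_def P_def)
  qed simp
  obtain m' where m: "m = Suc m'"
    using assms(1) by (cases m) auto
  have "T m' = P m' + (\<Sum>w\<in>{y m..min z (y m)}. taboo q y z m' w * Q_range q m m w (y m))"
    using taboo_renewal(1)[of m' m "y m" y q z] by (simp add: m T_def P_def)
  also have "(\<Sum>w\<in>{y m..min z (y m)}. taboo q y z m' w * Q_range q m m w (y m)) = 0"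
    by (intro sum.neutral) (auto simp: Q_range_refl Q_kernel_def)
  finally have "T 0 = (\<Sum>k<m. P k)"
    using telescope[of m'] by (simp add: m)
  moreover have "T 0 = Q_range q 1 m z (y m)"
  proof (cases "y m \<le> z")
    case True
    then show ?thesis by (simp add: T_def of_bool_def if_distrib if_distribR sum.delta cong: if_cong)
  next
    case False
    then show ?thesis using assms(1) by (simp add: T_def Q_range_eq_0)
  qed
  moreover have "passage_kernel q y m z (y m) = (\<Sum>k<m. P k)"
    unfolding passage_kernel_def P_def
  proof (intro sum.cong refl)
    fix k w assume "k \<in> {..<m}" and "w \<in> {y (Suc k)<..z}"
    then show "taboo q y z k w * Q_bar q (Suc k) m w (y m)
        = taboo q y z k w * Q_range q (Suc k) m w (y m)"
      using assms(2)[of k] by (simp add: Q_bar_def Q_dag_range_eq_0)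
  qed
  ultimately show ?thesis by simp
qed

section \<open>The boundary value problem\<close>

text \<open>
  The level \<open>\<ell>\<close> of \<open>h\<close> is read as \<open>n - m\<close>. In this numbering the recursion at step \<open>m\<close> involves only
  \<open>q m\<close> and \<open>y m\<close>, so that all the functions \<open>h (n - i)\<close>, \<open>i < m\<close>, obey the same relation and can be
  summed before \<open>m\<close> is lowered.
\<close>
lemma boundary_value_sum_eq_passage_kernel:
  assumes q: "\<And>l. 1 \<le> l \<Longrightarrow> l \<le> n \<Longrightarrow> q l \<noteq> 0"
    and y: "\<And>k m. k < m \<Longrightarrow> m \<le> n \<Longrightarrow> y m \<le> y (Suc k)"
    and h: "\<And>k. k \<le> n - 1 \<Longrightarrow> terminal_boundary_solution q y n k (h k)"
    and "m \<le> n"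
  shows "(\<Sum>i=1..m. Q_range q 1 i z (y i) * h (n - i) (n - m) x) = passage_kernel q y m z x"
  using \<open>m \<le> n\<close>
proof (induction m arbitrary: x)
  case 0
  then show ?case by (simp add: passage_kernel_def)
next
  case (Suc m)
  have q0: "q (Suc m) \<noteq> 0" using q Suc by simp
  have top: "h (n - Suc m) (n - Suc m) x = q (Suc m) powi (x - y (Suc m))" for x
    using h[of "n - Suc m"] Suc.prems by (simp add: terminal_boundary_solution_def)
  have "h (n - Suc m) (n - Suc m) = (\<lambda>x. q (Suc m) powi (x - y (Suc m)))"
    by (rule ext) (rule top)
  then have diff_top: "twisted_diff (q (Suc m)) (h (n - Suc m) (n - Suc m)) x = 0" for x
    by (simp add: twisted_diff_power_int[OF q0])
  have inner: "twisted_diff (q (Suc m)) (h (n - i) (n - Suc m)) x = h (n - i) (n - m) x"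
    and inner0: "h (n - i) (n - Suc m) (y (Suc m)) = 0" if "i \<in> {1..m}" for i x
  proof -
    have sol: "terminal_boundary_solution q y n (n - i) (h (n - i))" "n - Suc m < n - i"
      "Suc (n - Suc m) = n - m" "n - (n - Suc m) = Suc m"
      using h that Suc.prems by auto
    then show "twisted_diff (q (Suc m)) (h (n - i) (n - Suc m)) x = h (n - i) (n - m) x"
      "h (n - i) (n - Suc m) (y (Suc m)) = 0"
      unfolding terminal_boundary_solution_def twisted_diff_def by force+
  qed
  show ?case
  proof (rule twisted_diff_unique[OF q0])
    fix x
    have "twisted_diff (q (Suc m))
        (\<lambda>x. \<Sum>i=1..Suc m. Q_range q 1 i z (y i) * h (n - i) (n - Suc m) x) x
      = (\<Sum>i=1..m. Q_range q 1 i z (y i) * h (n - i) (n - m) x)"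
      unfolding twisted_diff_sum twisted_diff_cmult
      by (simp add: inner diff_top)
    then show "twisted_diff (q (Suc m))
        (\<lambda>x. \<Sum>i=1..Suc m. Q_range q 1 i z (y i) * h (n - i) (n - Suc m) x) x
      = twisted_diff (q (Suc m)) (passage_kernel q y (Suc m) z) x"
      using Suc by (simp add: twisted_diff_passage_kernel[of q, OF q0])
  next
    show "(\<Sum>i=1..Suc m. Q_range q 1 i z (y i) * h (n - i) (n - Suc m) (y (Suc m)))
      = passage_kernel q y (Suc m) z (y (Suc m))"
      using Suc.prems y by (subst passage_kernel_boundary) (auto simp: inner0 top)
  qed
qed

section \<open>The law of the geometric walk\<close>

lemma measurable_history:
  fixes S :: "nat \<Rightarrow> 'a \<Rightarrow> int"
  assumes "\<And>i. i < m \<Longrightarrow> S i \<in> M \<rightarrow>\<^sub>M count_space UNIV"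
  shows "(\<lambda>\<omega>. map (\<lambda>i. S i \<omega>) [0..<m]) \<in> M \<rightarrow>\<^sub>M count_space UNIV"
proof -
  let ?past = "\<lambda>\<omega>. map (\<lambda>i. S i \<omega>) [0..<m]"
  have "?past -` {xs} \<inter> space M \<in> sets M" for xs
  proof (cases "length xs = m")
    case True
    have coord: "{\<omega>\<in>space M. S i \<omega> = xs ! i} \<in> sets M" if "i < m" for i
    proof -
      have "S i -` {xs ! i} \<inter> space M \<in> sets M"
        by (rule measurable_sets[OF assms[OF that]]) simp
      also have "S i -` {xs ! i} \<inter> space M = {\<omega>\<in>space M. S i \<omega> = xs ! i}"
        by blast
      finally show ?thesis .
    qed
    have "{\<omega>\<in>space M. \<forall>i\<in>{..<m}. S i \<omega> = xs ! i} \<in> sets M"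
      by (rule sets.sets_Collect_finite_All) (simp_all add: coord)
    also have "{\<omega>\<in>space M. \<forall>i\<in>{..<m}. S i \<omega> = xs ! i} = ?past -` {xs} \<inter> space M"
      unfolding vimage_def list_eq_iff_nth_eq singleton_iff using True by fastforce
    finally show ?thesis .
  next
    case False
    then have "?past \<omega> \<noteq> xs" for \<omega> by (metis length_map length_upt diff_zero)
    then have "?past -` {xs} \<inter> space M = {}" by blast
    then show ?thesis by (metis sets.empty_sets)
  qed
  then show ?thesis
    using measurable_count_space_eq_countable[OF countableI_type, of ?past M] by blast
qed

text \<open>
  A path up to time \<open>n\<close> takes values in a countable discrete space, on which everything is
  measurable. The functional is allowed to be defined on infinite sequences, as long as it
  depends only on the coordinates up to \<open>n\<close>; events and the hitting time can then be used
  directly in their natural form.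
\<close>
lemma measurable_path_functional:
  fixes S :: "nat \<Rightarrow> 'a \<Rightarrow> int" and \<phi> :: "(nat \<Rightarrow> int) \<Rightarrow> 'b"
  assumes S: "\<And>l. l \<le> n \<Longrightarrow> S l \<in> M \<rightarrow>\<^sub>M count_space UNIV"
    and local: "\<And>f g. (\<And>i. i \<le> n \<Longrightarrow> f i = g i) \<Longrightarrow> \<phi> f = \<phi> g"
    and "space N = UNIV"
  shows "(\<lambda>\<omega>. \<phi> (\<lambda>i. S i \<omega>)) \<in> M \<rightarrow>\<^sub>M N"
proof -
  let ?past = "\<lambda>\<omega>. map (\<lambda>i. S i \<omega>) [0..<Suc n]"
  have past: "?past \<in> M \<rightarrow>\<^sub>M count_space UNIV"
    by (rule measurable_history) (simp add: S)
  have "(\<lambda>xs. \<phi> (\<lambda>i. xs ! i)) \<in> count_space UNIV \<rightarrow>\<^sub>M N"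
    using assms(3) by simp
  from measurable_compose[OF past this] have "(\<lambda>\<omega>. \<phi> (\<lambda>i. ?past \<omega> ! i)) \<in> M \<rightarrow>\<^sub>M N" .
  also have "(\<lambda>\<omega>. \<phi> (\<lambda>i. ?past \<omega> ! i)) = (\<lambda>\<omega>. \<phi> (\<lambda>i. S i \<omega>))"
  proof (rule ext, rule local)
    fix \<omega> i assume "i \<le> n"
    then show "?past \<omega> ! i = S i \<omega>"
      by (subst nth_map) (simp_all del: upt_Suc)
  qed
  finally show ?thesis .
qed

lemma geometric_walk_path_event:
  fixes S :: "nat \<Rightarrow> 'a \<Rightarrow> int"
  assumes "geometric_walk M q n z S"
    and "\<And>f g. (\<And>i. i \<le> n \<Longrightarrow> f i = g i) \<Longrightarrow> P f = P g"
  shows "{\<omega>\<in>space M. P (\<lambda>i. S i \<omega>)} \<in> sets M"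
proof -
  have "S l \<in> M \<rightarrow>\<^sub>M count_space UNIV" if "l \<le> n" for l
    using assms(1) that by (simp add: geometric_walk_def)
  then have "Measurable.pred M (\<lambda>\<omega>. P (\<lambda>i. S i \<omega>))"
    by (rule measurable_path_functional[where \<phi> = P, OF _ assms(2)]) simp_all
  then show ?thesis by (simp add: pred_def)
qed

text \<open>
  The event \<open>A\<close> of the past, intersected with \<open>S k = v\<close>, is a countable disjoint union of single
  histories. For each of them the defining conditional probability is the same number \<open>p\<close>, since
  it depends on the history only through its last entry \<open>v\<close>; histories of probability zero
  contribute nothing on either side.
\<close>
lemma geometric_walk_markov:
  fixes S :: "nat \<Rightarrow> 'a \<Rightarrow> int"
  assumes walk: "geometric_walk M q n z S" and "k < n" and "1 < q (Suc k)"
  defines "past \<equiv> \<lambda>\<omega>. map (\<lambda>i. S i \<omega>) [0..<Suc k]"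
  shows "measure M {\<omega>\<in>space M. A (past \<omega>) \<and> S k \<omega> = v \<and> S (Suc k) \<omega> = b} =
    measure M {\<omega>\<in>space M. A (past \<omega>) \<and> S k \<omega> = v} * ((q (Suc k) - 1) * Q_kernel q (Suc k) v b)"
proof -
  interpret prob_space M using walk by (simp add: geometric_walk_def)
  define p where "p = (q (Suc k) - 1) * Q_kernel q (Suc k) v b"
  have p: "0 \<le> p" using assms(3) by (simp add: p_def Q_kernel_def)
  define I where "I = {xs. length xs = Suc k \<and> A xs \<and> xs ! k = v}"
  have past_eq: "past \<omega> = xs \<longleftrightarrow> length xs = Suc k \<and> (\<forall>i<Suc k. S i \<omega> = xs ! i)" for \<omega> xs
    unfolding past_def by (auto simp: list_eq_iff_nth_eq simp del: upt_Suc)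
  have past_k: "past \<omega> ! k = S k \<omega>" "length (past \<omega>) = Suc k" for \<omega>
    by (simp_all add: past_def del: upt_Suc)
  have [measurable]: "past \<in> M \<rightarrow>\<^sub>M count_space UNIV" "S (Suc k) \<in> M \<rightarrow>\<^sub>M count_space UNIV"
    unfolding past_def using walk assms(2)
    by (auto simp: geometric_walk_def simp del: upt_Suc intro!: measurable_history)
  have sets: "{\<omega>\<in>space M. past \<omega> = xs} \<in> sets M"
    "{\<omega>\<in>space M. past \<omega> = xs \<and> S (Suc k) \<omega> = b} \<in> sets M" for xs
    by measurable
  have point: "emeasure M {\<omega>\<in>space M. past \<omega> = xs \<and> S (Suc k) \<omega> = b} =
    emeasure M {\<omega>\<in>space M. past \<omega> = xs} * ennreal p" if "xs \<in> I" for xs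
  proof -
    have hist: "{\<omega>\<in>space M. past \<omega> = xs} = {\<omega>\<in>space M. \<forall>i<Suc k. S i \<omega> = xs ! i}"
      and hist': "{\<omega>\<in>space M. past \<omega> = xs \<and> S (Suc k) \<omega> = b} =
        {\<omega>\<in>space M. S (Suc k) \<omega> = b \<and> (\<forall>i<Suc k. S i \<omega> = xs ! i)}"
      using that by (auto simp: past_eq I_def)
    have "measure M {\<omega>\<in>space M. past \<omega> = xs \<and> S (Suc k) \<omega> = b} =
      measure M {\<omega>\<in>space M. past \<omega> = xs} * p"
    proof (cases "measure M {\<omega>\<in>space M. past \<omega> = xs} = 0")
      case True
      have "measure M {\<omega>\<in>space M. past \<omega> = xs \<and> S (Suc k) \<omega> = b}
          \<le> measure M {\<omega>\<in>space M. past \<omega> = xs}"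
        by (intro finite_measure_mono sets) auto
      then show ?thesis using True measure_nonneg[of M] by (simp add: antisym)
    next
      case False
      then have pos: "0 < measure M {\<omega>\<in>space M. \<forall>i<Suc k. S i \<omega> = xs ! i}"
        by (simp add: hist zero_less_measure_iff)
      have step: "\<forall>l\<in>{1..n}. \<forall>(x :: nat \<Rightarrow> int) b.
        \<P>(\<omega> in M. \<forall>i<l. S i \<omega> = x i) > 0 \<longrightarrow>
        \<P>(\<omega> in M. S l \<omega> = b \<bar> \<forall>i<l. S i \<omega> = x i) =
          (q l - 1) * q l powi (b - x (l - 1)) * of_bool (b < x (l - 1))"
        using walk by (simp add: geometric_walk_def)
      have "\<P>(\<omega> in M. S (Suc k) \<omega> = b \<bar> \<forall>i<Suc k. S i \<omega> = xs ! i) =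
          (q (Suc k) - 1) * q (Suc k) powi (b - xs ! k) * of_bool (b < xs ! k)"
        using step[rule_format, of "Suc k" "\<lambda>i. xs ! i" b] pos assms(2) by simp
      also have "\<dots> = p" using that by (simp add: I_def p_def Q_kernel_def)
      finally show ?thesis
        using pos by (simp add: cond_prob_def hist hist' field_simps)
    qed
    then show ?thesis
      using p by (simp add: emeasure_eq_measure ennreal_mult)
  qed
  have "emeasure M {\<omega>\<in>space M. A (past \<omega>) \<and> S k \<omega> = v \<and> S (Suc k) \<omega> = b} =
    emeasure M (\<Union>xs\<in>I. {\<omega>\<in>space M. past \<omega> = xs \<and> S (Suc k) \<omega> = b})"
    by (intro arg_cong[where f = "emeasure M"]) (auto simp: I_def past_k)
  also have "\<dots> = (\<integral>\<^sup>+xs. emeasure M {\<omega>\<in>space M. past \<omega> = xs \<and> S (Suc k) \<omega> = b} \<partial>count_space I)"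
    by (intro emeasure_UN_countable) (auto simp: disjoint_family_on_def sets)
  also have "\<dots> = (\<integral>\<^sup>+xs. emeasure M {\<omega>\<in>space M. past \<omega> = xs} * ennreal p \<partial>count_space I)"
    by (intro nn_integral_cong) (simp add: point)
  also have "\<dots> = (\<integral>\<^sup>+xs. emeasure M {\<omega>\<in>space M. past \<omega> = xs} \<partial>count_space I) * ennreal p"
    by (intro nn_integral_multc) simp
  also have "(\<integral>\<^sup>+xs. emeasure M {\<omega>\<in>space M. past \<omega> = xs} \<partial>count_space I) =
    emeasure M (\<Union>xs\<in>I. {\<omega>\<in>space M. past \<omega> = xs})"
    by (intro emeasure_UN_countable[symmetric]) (auto simp: disjoint_family_on_def sets)
  also have "(\<Union>xs\<in>I. {\<omega>\<in>space M. past \<omega> = xs}) = {\<omega>\<in>space M. A (past \<omega>) \<and> S k \<omega> = v}"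
    by (auto simp: I_def past_k)
  finally show ?thesis
    using p by (simp add: p_def[symmetric] emeasure_eq_measure ennreal_mult[symmetric])
qed

text \<open>
  The transition kernel gives probability zero to each single step from \<open>v\<close> to some \<open>b \<ge> v\<close>; countability of the
  integers turns this into an almost sure statement.
\<close>
lemma geometric_walk_decreasing:
  fixes S :: "nat \<Rightarrow> 'a \<Rightarrow> int"
  assumes walk: "geometric_walk M q n z S" and "k < n" and "1 < q (Suc k)"
  shows "AE \<omega> in M. S (Suc k) \<omega> < S k \<omega>"
proof -
  interpret prob_space M using walk by (simp add: geometric_walk_def)
  have "AE \<omega> in M. v \<le> b \<longrightarrow> \<not> (S k \<omega> = v \<and> S (Suc k) \<omega> = b)" for v b
  proof (cases "v \<le> b")
    case True
    have "measure M {\<omega>\<in>space M. S k \<omega> = v \<and> S (Suc k) \<omega> = b} = 0"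
      using geometric_walk_markov[OF assms, where A = "\<lambda>_. True", of v b] True
      by (simp add: Q_kernel_def)
    moreover have "{\<omega>\<in>space M. S k \<omega> = v \<and> S (Suc k) \<omega> = b} \<in> sets M"
      by (rule geometric_walk_path_event[OF walk,
          where P = "\<lambda>f. f k = v \<and> f (Suc k) = b"])
        (use assms(2) in simp)
    ultimately have "AE \<omega> in M. \<not> (S k \<omega> = v \<and> S (Suc k) \<omega> = b)"
      by (simp add: prob_eq_0)
    then show ?thesis by eventually_elim simp
  qed simp
  then have "AE \<omega> in M. \<forall>v b. v \<le> b \<longrightarrow> \<not> (S k \<omega> = v \<and> S (Suc k) \<omega> = b)"
    unfolding AE_all_countable by blast
  then show ?thesis by eventually_elim (metis not_le)
qed

lemma geometric_walk_le_start:
  fixes S :: "nat \<Rightarrow> 'a \<Rightarrow> int"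
  assumes walk: "geometric_walk M q n z S" and "\<And>l. 1 \<le> l \<Longrightarrow> l \<le> n \<Longrightarrow> 1 < q l" and "k \<le> n"
  shows "AE \<omega> in M. S k \<omega> \<le> z"
  using assms(3)
proof (induction k)
  case 0
  have "AE \<omega> in M. S 0 \<omega> = z" using walk by (simp add: geometric_walk_def)
  then show ?case by eventually_elim simp
next
  case (Suc k)
  have "AE \<omega> in M. S (Suc k) \<omega> < S k \<omega>"
    using Suc.prems assms(2) by (intro geometric_walk_decreasing[OF walk]) auto
  moreover have "AE \<omega> in M. S k \<omega> \<le> z" using Suc by simp
  ultimately show ?case by eventually_elim simp
qed

text \<open>
  One step of the recursion: almost surely the position at time \<open>k\<close> is one of the finitely many
  \<open>v\<close> occurring in the definition of \<open>taboo\<close>, and the Markov property gives the weight of each.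
\<close>
lemma prob_taboo:
  fixes S :: "nat \<Rightarrow> 'a \<Rightarrow> int"
  assumes walk: "geometric_walk M q n z S" and q: "\<And>l. 1 \<le> l \<Longrightarrow> l \<le> n \<Longrightarrow> 1 < q l" and "k \<le> n"
  shows "measure M {\<omega>\<in>space M. (\<forall>j<k. S j \<omega> \<le> y (Suc j)) \<and> S k \<omega> = w} =
    (\<Prod>l=1..k. (q l - 1)) * taboo q y z k w"
  using assms(3)
proof (induction k arbitrary: w)
  case 0
  interpret prob_space M using walk by (simp add: geometric_walk_def)
  have event: "{\<omega>\<in>space M. S 0 \<omega> = w} \<in> sets M" for w
    by (rule geometric_walk_path_event[OF walk, where P = "\<lambda>f. f 0 = w"]) simp
  have start: "AE \<omega> in M. S 0 \<omega> = z" using walk by (simp add: geometric_walk_def)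
  show ?case
  proof (cases "w = z")
    case True
    then show ?thesis using start by (simp add: prob_eq_1 event)
  next
    case False
    have "AE \<omega> in M. S 0 \<omega> \<noteq> w" using start by eventually_elim (use False in simp)
    then show ?thesis using False by (simp add: prob_eq_0 event)
  qed
next
  case (Suc k)
  interpret prob_space M using walk by (simp add: geometric_walk_def)
  let ?V = "{w<..min z (y (Suc k))}"
  let ?E = "\<lambda>v. {\<omega>\<in>space M. (\<forall>j<k. S j \<omega> \<le> y (Suc j)) \<and> S k \<omega> = v \<and> S (Suc k) \<omega> = w}"
  have E: "?E v \<in> sets M" for v
    by (rule geometric_walk_path_event[OF walk,
        where P = "\<lambda>f. (\<forall>j<k. f j \<le> y (Suc j)) \<and> f k = v \<and> f (Suc k) = w"])
      (use Suc.prems in simp)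
  have step: "measure M (?E v) = (\<Prod>l=1..k. (q l - 1)) * taboo q y z k v *
      ((q (Suc k) - 1) * Q_kernel q (Suc k) v w)" for v
    using geometric_walk_markov[OF walk, of k "\<lambda>xs. \<forall>j<k. xs ! j \<le> y (Suc j)" v w] Suc q
    by (simp del: upt_Suc)
  have decr: "AE \<omega> in M. S (Suc k) \<omega> < S k \<omega>"
    using Suc.prems q by (intro geometric_walk_decreasing[OF walk]) auto
  have le: "AE \<omega> in M. S k \<omega> \<le> z"
    using Suc.prems q by (intro geometric_walk_le_start[OF walk]) auto
  have "measure M {\<omega>\<in>space M. (\<forall>j<Suc k. S j \<omega> \<le> y (Suc j)) \<and> S (Suc k) \<omega> = w} =
    measure M (\<Union>v\<in>?V. ?E v)"
  proof (rule measure_eq_AE)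
    show "AE \<omega> in M. \<omega> \<in> {\<omega>\<in>space M. (\<forall>j<Suc k. S j \<omega> \<le> y (Suc j)) \<and> S (Suc k) \<omega> = w}
      \<longleftrightarrow> \<omega> \<in> (\<Union>v\<in>?V. ?E v)"
      using decr le by eventually_elim (auto simp: less_Suc_eq)
    show "{\<omega>\<in>space M. (\<forall>j<Suc k. S j \<omega> \<le> y (Suc j)) \<and> S (Suc k) \<omega> = w} \<in> sets M"
      by (rule geometric_walk_path_event[OF walk,
          where P = "\<lambda>f. (\<forall>j<Suc k. f j \<le> y (Suc j)) \<and> f (Suc k) = w"])
        (use Suc.prems in simp)
    show "(\<Union>v\<in>?V. ?E v) \<in> sets M"
      by (rule sets.finite_UN) (rule finite_greaterThanAtMost_int, rule E)
  qed
  also have "\<dots> = (\<Sum>v\<in>?V. measure M (?E v))"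
  proof (rule finite_measure_finite_Union)
    show "?E ` ?V \<subseteq> sets M" using E by blast
    show "disjoint_family_on ?E ?V" unfolding disjoint_family_on_def by blast
  qed (rule finite_greaterThanAtMost_int)
  also have "\<dots> = (\<Prod>l=1..Suc k. (q l - 1)) * taboo q y z (Suc k) w"
    unfolding step taboo.simps sum_distrib_left by (intro sum.cong) (simp_all add: mult_ac)
  finally show ?case .
qed

section \<open>The walk at the hitting time\<close>

text \<open>
  Exactly one summand survives, namely \<open>k = \<tau>\<close> and \<open>w = S \<tau>\<close>, and none if \<open>\<tau> = n\<close>. Since
  passing the barrier at a time \<open>k < n\<close> means \<open>y (k + 1) < S k \<le> z\<close>, finitely many \<open>w\<close> suffice.
\<close>
lemma hitting_time_decomposition:
  fixes F :: "nat \<Rightarrow> int \<Rightarrow> real"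
  assumes "\<And>k. k < n \<Longrightarrow> S k \<omega> \<le> z"
  shows "F (hitting_time y n S \<omega>) (S (hitting_time y n S \<omega>) \<omega>) * of_bool (hitting_time y n S \<omega> < n)
    = (\<Sum>k<n. \<Sum>w\<in>{y (Suc k)<..z}. of_bool ((\<forall>j<k. S j \<omega> \<le> y (Suc j)) \<and> S k \<omega> = w) * F k w)"
proof -
  define \<tau> where "\<tau> = hitting_time y n S \<omega>"
  define H where "H = {m \<in> {0..n}. ereal (of_int (S m \<omega>)) > barrier y n (m + 1)}"
  have H: "finite H" "n \<in> H" by (auto simp: H_def barrier_def)
  have H_iff: "k \<in> H \<longleftrightarrow> y (Suc k) < S k \<omega>" if "k < n" for k
    using that by (simp add: H_def barrier_def)
  have "\<tau> = Min H"
    by (simp add: \<tau>_def hitting_time_def H_def)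
  then have \<tau>: "\<tau> \<in> H" "\<And>j. j < \<tau> \<Longrightarrow> j \<notin> H"
    using Min_in[of H] Min_le[of H] H by (metis empty_iff, metis not_le)
  have first: "(\<forall>j<k. S j \<omega> \<le> y (Suc j)) \<and> y (Suc k) < S k \<omega> \<longleftrightarrow> k = \<tau>" if "k < n" for k
  proof
    assume k: "(\<forall>j<k. S j \<omega> \<le> y (Suc j)) \<and> y (Suc k) < S k \<omega>"
    then have "k \<in> H" "\<forall>j<k. j \<notin> H" using that H_iff by (auto simp: not_less)
    then show "k = \<tau>" using \<tau> by (meson linorder_neqE_nat)
  next
    assume "k = \<tau>"
    then show "(\<forall>j<k. S j \<omega> \<le> y (Suc j)) \<and> y (Suc k) < S k \<omega>"
      using \<tau> H_iff that by (meson less_trans not_less)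
  qed
  have inner: "(\<Sum>w\<in>{y (Suc k)<..z}. of_bool ((\<forall>j<k. S j \<omega> \<le> y (Suc j)) \<and> S k \<omega> = w) * F k w) =
      (if k = \<tau> then F k (S k \<omega>) else 0)" if "k < n" for k
  proof -
    have "(\<Sum>w\<in>{y (Suc k)<..z}. of_bool ((\<forall>j<k. S j \<omega> \<le> y (Suc j)) \<and> S k \<omega> = w) * F k w) =
      (\<Sum>w\<in>{y (Suc k)<..z}. if S k \<omega> = w then of_bool (\<forall>j<k. S j \<omega> \<le> y (Suc j)) * F k w else 0)"
      by (intro sum.cong) auto
    also have "\<dots> = (if (\<forall>j<k. S j \<omega> \<le> y (Suc j)) \<and> y (Suc k) < S k \<omega> then F k (S k \<omega>) else 0)"
      using assms[OF that] by (simp add: sum.delta')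
    finally show ?thesis by (simp only: first[OF that])
  qed
  have "(\<Sum>k<n. \<Sum>w\<in>{y (Suc k)<..z}. of_bool ((\<forall>j<k. S j \<omega> \<le> y (Suc j)) \<and> S k \<omega> = w) * F k w) =
    (\<Sum>k<n. if k = \<tau> then F k (S k \<omega>) else 0)"
    by (intro sum.cong refl inner) auto
  also have "\<dots> = F \<tau> (S \<tau> \<omega>) * of_bool (\<tau> < n)"
    by (simp add: sum.delta)
  finally show ?thesis by (simp add: \<tau>_def)
qed

lemma expectation_at_hitting_time:
  fixes S :: "nat \<Rightarrow> 'a \<Rightarrow> int" and F :: "nat \<Rightarrow> int \<Rightarrow> real"
  assumes walk: "geometric_walk M q n z S" and q: "\<And>l. 1 \<le> l \<Longrightarrow> l \<le> n \<Longrightarrow> 1 < q l"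
  shows "prob_space.expectation M (\<lambda>\<omega>. F (hitting_time y n S \<omega>) (S (hitting_time y n S \<omega>) \<omega>)
      * of_bool (hitting_time y n S \<omega> < n)) =
    (\<Sum>k<n. \<Sum>w\<in>{y (Suc k)<..z}. (\<Prod>l=1..k. (q l - 1)) * taboo q y z k w * F k w)"
proof -
  interpret prob_space M using walk by (simp add: geometric_walk_def)
  let ?f = "\<lambda>\<omega>. F (hitting_time y n S \<omega>) (S (hitting_time y n S \<omega>) \<omega>)
      * of_bool (hitting_time y n S \<omega> < n)"
  let ?E = "\<lambda>k w. {\<omega>\<in>space M. (\<forall>j<k. S j \<omega> \<le> y (Suc j)) \<and> S k \<omega> = w}"
  let ?g = "\<lambda>\<omega>. \<Sum>k<n. \<Sum>w\<in>{y (Suc k)<..z}. indicat_real (?E k w) \<omega> * F k w"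
  have E: "?E k w \<in> sets M" if "k < n" for k w
    by (rule geometric_walk_path_event[OF walk,
        where P = "\<lambda>f. (\<forall>j<k. f j \<le> y (Suc j)) \<and> f k = w"])
      (use that in simp)
  (* The almost sure equality determines the integral only once measurability is known, and it
     does not follow from that equality because M need not be complete. *)
  have meas: "?f \<in> borel_measurable M"
  proof -
    let ?\<tau> = "\<lambda>f. hitting_time y n (\<lambda>i _. f i) ()"
    let ?\<phi> = "\<lambda>f. F (?\<tau> f) (f (?\<tau> f)) * of_bool (?\<tau> f < n)"
    have "(\<lambda>\<omega>. ?\<phi> (\<lambda>i. S i \<omega>)) \<in> borel_measurable M"
    proof (rule measurable_path_functional)
      fix f g :: "nat \<Rightarrow> int" assume fg: "\<And>i. i \<le> n \<Longrightarrow> f i = g i"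
      have "?\<tau> f = ?\<tau> g"
        unfolding hitting_time_def
        by (rule arg_cong[where f = Min], rule Collect_cong) (metis atLeastAtMost_iff fg)
      then show "?\<phi> f = ?\<phi> g"
        using fg by (cases "?\<tau> g < n") simp_all
    qed (use walk in \<open>simp_all add: geometric_walk_def\<close>)
    then show ?thesis by (simp only: hitting_time_def)
  qed
  have "AE \<omega> in M. \<forall>k<n. S k \<omega> \<le> z"
    using geometric_walk_le_start[OF walk q] by (simp add: AE_all_countable)
  then have eq: "AE \<omega> in M. ?f \<omega> = ?g \<omega>"
  proof (rule AE_mp, intro AE_I2 impI)
    fix \<omega> assume \<omega>: "\<omega> \<in> space M" "\<forall>k<n. S k \<omega> \<le> z"
    then show "?f \<omega> = ?g \<omega>"
      by (subst hitting_time_decomposition[of n S \<omega> z]) (auto simp: indicator_def)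
  qed
  have int: "integrable M (\<lambda>\<omega>. indicat_real (?E k w) \<omega> * F k w)" if "k < n" for k w
    by (intro integrable_mult_left integrable_real_indicator E[OF that])
      (simp add: emeasure_eq_measure)
  have g: "integrable M ?g"
    by (rule Bochner_Integration.integrable_sum, rule Bochner_Integration.integrable_sum,
        rule int, erule lessThan_iff[THEN iffD1])
  have indicator: "expectation (\<lambda>\<omega>. indicat_real A \<omega> * c) = measure M A * c" if "A \<in> sets M" for A c
    using that by (simp add: Int_absorb2 sets.sets_into_space)
  have "expectation ?f = expectation ?g"
    by (rule integral_cong_AE[OF meas borel_measurable_integrable[OF g] eq])
  also have "\<dots> = (\<Sum>k<n. expectation
      (\<lambda>\<omega>. \<Sum>w\<in>{y (Suc k)<..z}. indicat_real (?E k w) \<omega> * F k w))"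
    by (rule Bochner_Integration.integral_sum, rule Bochner_Integration.integrable_sum,
        rule int, erule lessThan_iff[THEN iffD1])
  also have "\<dots> = (\<Sum>k<n. \<Sum>w\<in>{y (Suc k)<..z}. measure M (?E k w) * F k w)"
  proof (rule sum.cong[OF refl])
    fix k assume "k \<in> {..<n}"
    then have k: "k < n" by simp
    have "expectation (\<lambda>\<omega>. \<Sum>w\<in>{y (Suc k)<..z}. indicat_real (?E k w) \<omega> * F k w) =
        (\<Sum>w\<in>{y (Suc k)<..z}. expectation (\<lambda>\<omega>. indicat_real (?E k w) \<omega> * F k w))"
      by (rule Bochner_Integration.integral_sum) (rule int[OF k])
    then show "expectation (\<lambda>\<omega>. \<Sum>w\<in>{y (Suc k)<..z}. indicat_real (?E k w) \<omega> * F k w) =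
        (\<Sum>w\<in>{y (Suc k)<..z}. measure M (?E k w) * F k w)"
      by (simp only: indicator[OF E[OF k]])
  qed
  also have "\<dots> = (\<Sum>k<n. \<Sum>w\<in>{y (Suc k)<..z}. (\<Prod>l=1..k. (q l - 1)) * taboo q y z k w * F k w)"
  proof (intro sum.cong refl)
    fix k w assume "k \<in> {..<n}"
    then have "measure M (?E k w) = (\<Prod>l=1..k. (q l - 1)) * taboo q y z k w"
      by (intro prob_taboo[OF walk q]) simp_all
    then show "measure M (?E k w) * F k w = (\<Prod>l=1..k. (q l - 1)) * taboo q y z k w * F k w"
      by (rule arg_cong[where f = "\<lambda>p. p * F k w"])
  qed
  finally show ?thesis .
qed

theorem proposition4p6:
  fixes N n :: nat
    and q :: "nat \<Rightarrow> real"
    and y :: "nat \<Rightarrow> int"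
    and h :: "nat \<Rightarrow> nat \<Rightarrow> int \<Rightarrow> real"
    and M :: "'a measure"
    and S :: "nat \<Rightarrow> 'a \<Rightarrow> int"
    and z1 z2 :: int
  assumes "1 < q 1" and "strict_mono_on {1..N} q"
    and "strict_antimono_on {1..N} y"
    and "1 \<le> n" and "n \<le> N"
    and "\<And>k. k \<le> n - 1 \<Longrightarrow> terminal_boundary_solution q y n k (h k)"
    and "geometric_walk M q n z1 S"
  shows "G_kernel q y n h z1 z2 =
    prob_space.expectation M
      (\<lambda>\<omega>. Q_hat q (hitting_time y n S \<omega> + 1) n (S (hitting_time y n S \<omega>) \<omega>) z2
            * of_bool (hitting_time y n S \<omega> < n))
    / (\<Prod>l=1..n. (q l - 1))"
proof -
  have q: "1 < q l" if "1 \<le> l" "l \<le> n" for l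
  proof (cases "l = 1")
    case False
    then have "q 1 < q l"
      using that assms(5) by (intro strict_mono_onD[OF assms(2)]) auto
    then show ?thesis using assms(1) by simp
  qed (use assms(1) in simp)
  have y: "y m \<le> y (Suc k)" if "k < m" "m \<le> n" for k m
  proof (cases "m = Suc k")
    case False
    then show ?thesis
      using that assms(5) monotone_onD[OF assms(3), of "Suc k" m] by simp
  qed simp
  define P where "P = (\<lambda>k. \<Prod>l=1..k. (q l - 1))"
  have P: "P n \<noteq> 0" using q by (force simp: P_def)
  (* The factors in Q_hat over k < l <= n complete those of the walk up to time k. *)
  have split: "P k * (\<Prod>l=Suc k..n. (q l - 1)) = P n" if "k < n" for k
    using prod.ub_add_nat[of 1 k "\<lambda>l. q l - 1" "n - k"] that by (simp add: P_def)
  have "prob_space.expectation M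
      (\<lambda>\<omega>. Q_hat q (hitting_time y n S \<omega> + 1) n (S (hitting_time y n S \<omega>) \<omega>) z2
            * of_bool (hitting_time y n S \<omega> < n))
    = (\<Sum>k<n. \<Sum>w\<in>{y (Suc k)<..z1}. P k * taboo q y z1 k w * Q_hat q (k + 1) n w z2)"
    unfolding P_def by (rule expectation_at_hitting_time[OF assms(7) q])
  also have "\<dots> = P n * passage_kernel q y n z1 z2"
    unfolding passage_kernel_def sum_distrib_left
    by (intro sum.cong refl) (simp add: Q_hat_def split[symmetric])
  also have "passage_kernel q y n z1 z2 = G_kernel q y n h z1 z2"
    using boundary_value_sum_eq_passage_kernel[of n q y h n z1 z2] q y assms(6)
    by (force simp: G_kernel_def)
  finally show ?thesis using P by (simp add: P_def)
qed

end
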